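(* Every metric space on at most four points can be reconstructed from its $q$-spectrum. That is, if $X$ and $X'$ are metric spaces each with at most four points and having the same $q$-spectrum, then $X$ and $X'$ are isometric.
   Context: Let $(X,d)$ be a finite metric space, $X=\{x_1,\dots,x_n\}$, $d_{ij}=d(x_i,x_j)$. The similarity matrix of $X$ is the $n\times n$ matrix $Z(q)=(q^{d_{ij}})_{i,j}$, where $q$ is a formal parameter (equivalently, $q$ ranges over real numbers in $(0,1)$). The $q$-spectrum of $X$ is the multiset $[\lambda_1(q),\dots,\lambda_n(q)]$ of eigenvalues of $Z(q)$. Two finite metric spaces have the same $q$-spectrum if these multisets agree for all $q\in(0,1)$; equivalently, the characteristic polynomials $|\lambda I-Z(q)|$ coincide, as polynomials in $\lambda$ whose coefficients are generalized polynomials in $q$ (real exponents allowed). *)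

theory Defs
  imports "HOL-Analysis.Analysis" "Jordan_Normal_Form.Char_Poly"
begin

text \<open>
  A finite metric space is a finite set \<open>X\<close> with a distance function \<open>d\<close> satisfying
  \<open>Metric_space X d\<close>; a duplicate-free list \<open>xs\<close> with \<open>set xs = X\<close> is an enumeration
  \<open>x\<^sub>1, \<dots>, x\<^sub>n\<close> of its points.  For \<open>0 < q\<close>, \<open>q powr d x y\<close> is the
  real power, so diagonal entries of the similarity matrix are 1.

  The matrix is taken over the complex numbers so that its characteristic polynomial splits
  and the multiset of eigenvalues always has exactly \<open>n\<close> elements.  The matrix is real symmetric,
  so all of them are in fact real.
\<close>

definition similarity_matrix :: "('a \<Rightarrow> 'a \<Rightarrow> real) \<Rightarrow> 'a list \<Rightarrow> real \<Rightarrow> complex mat" where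
  "similarity_matrix d xs q =
     mat (length xs) (length xs) (\<lambda>(i, j). complex_of_real (q powr d (xs ! i) (xs ! j)))"

text \<open>Eigenvalues counted with algebraic multiplicity.\<close>

definition eigenvalue_mset :: "complex mat \<Rightarrow> complex multiset" where
  "eigenvalue_mset A = proots (char_poly A)"

definition q_spectrum :: "('a \<Rightarrow> 'a \<Rightarrow> real) \<Rightarrow> 'a list \<Rightarrow> real \<Rightarrow> complex multiset" where
  "q_spectrum d xs q = eigenvalue_mset (similarity_matrix d xs q)"

definition isometric :: "'a set \<Rightarrow> ('a \<Rightarrow> 'a \<Rightarrow> real) \<Rightarrow> 'b set \<Rightarrow> ('b \<Rightarrow> 'b \<Rightarrow> real) \<Rightarrow> bool" where
  "isometric X d X' d' \<longleftrightarrow>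
     (\<exists>f. bij_betw f X X' \<and> (\<forall>x\<in>X. \<forall>y\<in>X. d' (f x) (f y) = d x y))"

end

theory Submission
  imports Defs
begin

text \<open>
  Evaluating the characteristic polynomial at \<open>1 + \<mu>\<close> with \<open>q = exp t\<close> gives a polynomial in
  \<open>\<mu>\<close> whose coefficients are exponential sums \<open>\<Sum> c exp (e t)\<close>.  If two such sums agree for
  \<open>t < 0\<close>, then so do all their derivatives, and letting \<open>t\<close> tend to \<open>0\<close> shows that the moments
  \<open>\<Sum> c e\<^sup>k\<close> agree.  So the spectrum determines polynomial expressions in the distances.

  For four points write \<open>a, a'\<close>, \<open>b, b'\<close>, \<open>c, c'\<close> for the lengths of opposite edges.  The constant
  coefficient (in \<open>\<mu>\<close>) determines the multiset of the \<open>m\<^sub>i\<close>, which are \<open>a + a'\<close>, \<open>b + b'\<close>,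
  \<open>c + c'\<close>; the triangle perimeters in the linear coefficient determine the multiset of the
  \<open>s\<^sub>i\<close>, which are \<open>(a - a')\<^sup>2\<close>, \<open>(b - b')\<^sup>2\<close>, \<open>(c - c')\<^sup>2\<close>, together with the product
  \<open>(a - a') (b - b') (c - c')\<close>.  The third and fourth power sums of the distances, from the quadratic
  coefficient, then give \<open>\<Sum> m\<^sub>i s\<^sub>i\<close> and \<open>\<Sum> m\<^sub>i\<^sup>2 s\<^sub>i\<close>, and a Vandermonde argument matches
  the \<open>m\<^sub>i\<close> with the \<open>s\<^sub>i\<close>.  What is left is an even number of sign changes of the differences,
  which is a relabelling by the Klein four-group.
\<close>

subsection \<open>Moments of exponential sums\<close>

text \<open>Coefficient-exponent pairs are kept in a list, so exponents may repeat; coinciding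
  distances need no separate treatment.\<close>

definition exp_sum :: "(real \<times> real) list \<Rightarrow> real \<Rightarrow> real" where
  "exp_sum L t = (\<Sum>(c, e)\<leftarrow>L. c * exp (e * t))"

definition moment :: "(real \<times> real) list \<Rightarrow> nat \<Rightarrow> real" where
  "moment L k = (\<Sum>(c, e)\<leftarrow>L. c * e ^ k)"

lemma moment_simps [simp]:
  "moment [] k = 0" "moment ((c, e) # L) k = c * e ^ k + moment L k"
  by (simp_all add: moment_def)

lemma exp_sum_simps [simp]:
  "exp_sum [] t = 0" "exp_sum ((c, e) # L) t = c * exp (e * t) + exp_sum L t"
  by (simp_all add: exp_sum_def)

definition deriv_coeffs :: "(real \<times> real) list \<Rightarrow> (real \<times> real) list" where
  "deriv_coeffs L = map (\<lambda>(c, e). (c * e, e)) L"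

lemma has_derivative_exp_sum: "(exp_sum L has_real_derivative exp_sum (deriv_coeffs L) t) (at t)"
proof (induction L)
  case (Cons p L)
  obtain c e where p: "p = (c, e)"
    by fastforce
  have "((\<lambda>t. c * exp (e * t) + exp_sum L t) has_real_derivative
      c * e * exp (e * t) + exp_sum (deriv_coeffs L) t) (at t)"
    by (auto intro!: derivative_eq_intros Cons.IH)
  then show ?case
    by (simp add: p deriv_coeffs_def exp_sum_def)
qed (simp add: exp_sum_def deriv_coeffs_def)

lemma moment_deriv_coeffs: "moment (deriv_coeffs L) k = moment L (Suc k)"
  by (induction L) (auto simp: deriv_coeffs_def moment_def)

text \<open>The moment of order \<open>k\<close> is the \<open>k\<close>-th derivative at 0. Only
  \<open>t < 0\<close> is available, because \<open>q = exp t\<close> lies below 1, so derivatives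
  are compared on the open half-line and 0 is reached by a left limit. Both lists vary in the
  induction, whose step passes to \<open>deriv_coeffs\<close>.\<close>

lemma exp_sum_eq_imp_moment_eq:
  assumes "\<And>t. t < 0 \<Longrightarrow> exp_sum L t = exp_sum L' t"
  shows "moment L k = moment L' k"
  using assms
proof (induction k arbitrary: L L')
  case 0
  have *: "(exp_sum K \<longlongrightarrow> moment K 0) (at_left 0)" for K
  proof -
    have "isCont (exp_sum K) 0"
      using has_derivative_exp_sum by (rule DERIV_isCont)
    moreover have "exp_sum K 0 = moment K 0"
      by (simp add: exp_sum_def moment_def)
    ultimately show ?thesis
      by (metis continuous_within filterlim_at_split)
  qed
  have "eventually (\<lambda>t. exp_sum L t = exp_sum L' t) (at_left 0)"
    using 0 by (auto simp: eventually_at_filter)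
  with * [of L] have "(exp_sum L' \<longlongrightarrow> moment L 0) (at_left 0)"
    by (rule Lim_transform_eventually)
  with * [of L'] show ?case
    by (meson tendsto_unique trivial_limit_at_left_real)
next
  case (Suc k)
  have "exp_sum (deriv_coeffs L) t = exp_sum (deriv_coeffs L') t" if "t < 0" for t
  proof -
    have "(exp_sum L' has_real_derivative exp_sum (deriv_coeffs L) t) (at t)"
      by (rule has_field_derivative_transform_within_open[OF has_derivative_exp_sum, of "{..<0}"])
        (use that Suc.prems in auto)
    with has_derivative_exp_sum show ?thesis
      by (rule DERIV_unique[symmetric])
  qed
  from Suc.IH[OF this] show ?case
    by (simp add: moment_deriv_coeffs)
qed

subsection \<open>Characteristic polynomials of similarity matrices\<close>

text \<open>A complex characteristic polynomial splits into monic linear factors, so equal spectra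
  give equal characteristic polynomials.\<close>

lemma char_poly_eq_prod_eigenvalue_mset:
  assumes A: "A \<in> carrier_mat n n"
  shows "char_poly A = (\<Prod>x\<in>#eigenvalue_mset A. [:- x, 1:])"
proof -
  obtain as where as: "char_poly A = (\<Prod>a\<leftarrow>as. [:- a, 1:])"
    using char_poly_factorized[OF A] by blast
  have "proots (\<Prod>a\<leftarrow>as. [:- a, 1:]) = mset as"
  proof (induction as)
    case (Cons a as)
    have "(\<Prod>a\<leftarrow>as. [:- a, 1:]) \<noteq> 0"
      by (auto simp: prod_list_zero_iff)
    with Cons show ?case
      by (simp add: proots_mult del: mult_pCons_left)
  qed simp
  with as show ?thesis
    by (simp add: eigenvalue_mset_def flip: prod_mset_prod_list)
qed

lemma size_eigenvalue_mset: "A \<in> carrier_mat n n \<Longrightarrow> size (eigenvalue_mset A) = n"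
  using degree_monic_char_poly[of A n] by (simp add: eigenvalue_mset_def size_proots_complex)

lemma similarity_matrix_carrier: "similarity_matrix d xs q \<in> carrier_mat (length xs) (length xs)"
  by (simp add: similarity_matrix_def)

text \<open>For a metric this is \<open>(1 + \<mu>) I - Z(exp t)\<close> over the reals. Shifting by
  the diagonal entry 1 of Z leaves only \<mu> on the diagonal, so a permutation with
  \<open>k\<close> fixed points contributes only to \<mu>^k.\<close>

definition shifted_char_mat :: "('a \<Rightarrow> 'a \<Rightarrow> real) \<Rightarrow> 'a list \<Rightarrow> real \<Rightarrow> real \<Rightarrow> real mat" where
  "shifted_char_mat d xs t \<mu> = mat (length xs) (length xs)
     (\<lambda>(i, j). if i = j then \<mu> else - exp (d (xs ! i) (xs ! j) * t))"

lemma poly_char_poly_similarity_matrix: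
  assumes "Metric_space (set xs) d"
  shows "poly (char_poly (similarity_matrix d xs (exp t))) (of_real (1 + \<mu>)) =
    of_real (det (shifted_char_mat d xs t \<mu>))"
proof -
  let ?n = "length xs"
  have [simp]: "d (xs ! i) (xs ! i) = 0" if "i < ?n" for i
    using assms that by (simp add: Metric_space.zero)
  have "poly (char_poly (similarity_matrix d xs (exp t))) (of_real (1 + \<mu>)) =
      det (map_mat complex_of_real (shifted_char_mat d xs t \<mu>))"
    unfolding char_poly_def
    by (rule poly_det_cong[of _ ?n])
      (auto simp: char_poly_matrix_def similarity_matrix_def shifted_char_mat_def powr_def)
  then show ?thesis
    by simp
qed

lemma q_spectrum_eq_imp_det_eq:
  assumes "Metric_space (set xs) d" and "Metric_space (set xs') d'"
    and eq: "\<forall>q\<in>{0<..<1}. q_spectrum d xs q = q_spectrum d' xs' q" and "t < 0"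
  shows "det (shifted_char_mat d xs t \<mu>) = det (shifted_char_mat d' xs' t \<mu>)"
proof -
  have "q_spectrum d xs (exp t) = q_spectrum d' xs' (exp t)"
    using eq \<open>t < 0\<close> by simp
  then have "char_poly (similarity_matrix d xs (exp t)) = char_poly (similarity_matrix d' xs' (exp t))"
    by (simp add: q_spectrum_def char_poly_eq_prod_eigenvalue_mset[OF similarity_matrix_carrier])
  then show ?thesis
    using poly_char_poly_similarity_matrix[OF assms(1), of t \<mu>]
      poly_char_poly_similarity_matrix[OF assms(2), of t \<mu>]
    by (simp del: of_real_add)
qed

lemma q_spectrum_eq_imp_length_eq:
  assumes "\<forall>q\<in>{0<..<1}. q_spectrum d xs q = q_spectrum d' xs' q"
  shows "length xs = length xs'"
proof -
  have "q_spectrum d xs (1 / 2) = q_spectrum d' xs' (1 / 2)"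
    using assms by simp
  then show ?thesis
    by (metis similarity_matrix_carrier q_spectrum_def size_eigenvalue_mset)
qed


section \<open>Determinants for two, three and four points\<close>

lemma det_mat_Suc:
  fixes f :: "nat \<times> nat \<Rightarrow> 'a :: comm_ring_1"
  shows "det (mat (Suc n) (Suc n) f) = (\<Sum>j<Suc n. f (0, j) * ((- 1) ^ j *
    det (mat n n (\<lambda>(i', j'). f (Suc i', if j' < j then j' else Suc j')))))"
proof -
  \<comment> \<open>Writing each minor as a \<open>mat\<close> again lets the row expansion be
    applied repeatedly by rewriting.\<close>
  have "mat_delete (mat (Suc n) (Suc n) f) 0 j =
      mat n n (\<lambda>(i', j'). f (Suc i', if j' < j then j' else Suc j'))" for j
    by (rule eq_matI) (auto simp: mat_delete_def)
  then show ?thesis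
    by (subst laplace_expansion_row[of _ "Suc n" 0]) (auto simp: cofactor_def intro!: sum.cong)
qed

lemma det_shifted_char_mat_2:
  assumes "d y x = d x y"
  shows "det (shifted_char_mat d [x, y] t \<mu>) = \<mu>^2 - exp (2 * d x y * t)"
proof -
  define a where "a = exp (d x y * t)"
  have "exp (2 * d x y * t) = a^2"
    unfolding a_def exp_of_nat_mult[symmetric] by (simp add: algebra_simps)
  then show ?thesis
    using assms
    by (simp add: shifted_char_mat_def det_mat_Suc numeral_2_eq_2 flip: a_def)
qed

lemma det_shifted_char_mat_3:
  assumes "d y x = d x y" "d z x = d x z" "d z y = d y z"
  shows "det (shifted_char_mat d [x, y, z] t \<mu>) =
    \<mu>^3 - \<mu> * (exp (2 * d x y * t) + exp (2 * d x z * t) + exp (2 * d y z * t))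
    - 2 * exp ((d x y + d x z + d y z) * t)"
proof -
  define a b c where "a = exp (d x y * t)" and "b = exp (d x z * t)" and "c = exp (d y z * t)"
  note defs = a_def b_def c_def
  have *: "exp (2 * d x y * t) = a^2" "exp (2 * d x z * t) = b^2" "exp (2 * d y z * t) = c^2"
    "exp ((d x y + d x z + d y z) * t) = a * b * c"
    by (simp_all add: defs power2_eq_square algebra_simps flip: exp_add)
  have "det (shifted_char_mat d [x, y, z] t \<mu>) =
    \<mu>^3 - \<mu> * (a^2 + b^2 + c^2) - 2 * (a * b * c)"
    using assms
    by (simp add: shifted_char_mat_def det_mat_Suc numeral_2_eq_2 flip: defs)
       (simp add: algebra_simps power3_eq_cube power2_eq_square)
  then show ?thesis
    unfolding * .
qed

text \<open>The terms are grouped by cycle type: transpositions give \<mu>^2, 3-cycles give \<mu>,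
  and double transpositions and 4-cycles give the constant term. The factors 2 count orientations of
  a cycle. A 4-cycle traverses two of the three perfect matchings, hence the exponents in the last
  three terms.\<close>

lemma det_shifted_char_mat_4:
  assumes "d y x = d x y" "d z x = d x z" "d w x = d x w"
    "d z y = d y z" "d w y = d y w" "d w z = d z w"
  shows "det (shifted_char_mat d [x, y, z, w] t \<mu>) = \<mu>^4
    - \<mu>^2 * (exp (2 * d x y * t) + exp (2 * d z w * t) + exp (2 * d x z * t)
      + exp (2 * d y w * t) + exp (2 * d x w * t) + exp (2 * d y z * t))
    - 2 * \<mu> * (exp ((d x y + d x z + d y z) * t) + exp ((d x y + d y w + d x w) * t)
      + exp ((d z w + d x z + d x w) * t) + exp ((d z w + d y w + d y z) * t))
    + exp (2 * (d x y + d z w) * t) + exp (2 * (d x z + d y w) * t) + exp (2 * (d x w + d y z) * t)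
    - 2 * exp ((d x y + d z w + d x z + d y w) * t)
    - 2 * exp ((d x y + d z w + d x w + d y z) * t)
    - 2 * exp ((d x z + d y w + d x w + d y z) * t)"
proof -
  define a a' b b' c c' where "a = exp (d x y * t)" and "a' = exp (d z w * t)"
    and "b = exp (d x z * t)" and "b' = exp (d y w * t)"
    and "c = exp (d x w * t)" and "c' = exp (d y z * t)"
  note defs = a_def a'_def b_def b'_def c_def c'_def
  have *: "exp (2 * d x y * t) = a^2" "exp (2 * d z w * t) = a'^2" "exp (2 * d x z * t) = b^2"
    "exp (2 * d y w * t) = b'^2" "exp (2 * d x w * t) = c^2" "exp (2 * d y z * t) = c'^2"
    "exp ((d x y + d x z + d y z) * t) = a * b * c'" "exp ((d x y + d y w + d x w) * t) = a * b' * c"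
    "exp ((d z w + d x z + d x w) * t) = a' * b * c" "exp ((d z w + d y w + d y z) * t) = a' * b' * c'"
    "exp (2 * (d x y + d z w) * t) = (a * a')^2" "exp (2 * (d x z + d y w) * t) = (b * b')^2"
    "exp (2 * (d x w + d y z) * t) = (c * c')^2"
    "exp ((d x y + d z w + d x z + d y w) * t) = a * a' * b * b'"
    "exp ((d x y + d z w + d x w + d y z) * t) = a * a' * c * c'"
    "exp ((d x z + d y w + d x w + d y z) * t) = b * b' * c * c'"
    by (simp_all add: defs power2_eq_square algebra_simps flip: exp_add)
  have "det (shifted_char_mat d [x, y, z, w] t \<mu>) = \<mu>^4
    - \<mu>^2 * (a^2 + a'^2 + b^2 + b'^2 + c^2 + c'^2)
    - 2 * \<mu> * (a * b * c' + a * b' * c + a' * b * c + a' * b' * c')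
    + (a * a')^2 + (b * b')^2 + (c * c')^2
    - 2 * (a * a' * b * b') - 2 * (a * a' * c * c') - 2 * (b * b' * c * c')"
    using assms
    by (simp add: shifted_char_mat_def det_mat_Suc numeral_2_eq_2 flip: defs)
       (simp add: algebra_simps power4_eq_xxxx power2_eq_square)
  then show ?thesis
    unfolding * .
qed

subsection \<open>Real numbers determined by power sums\<close>

text \<open>Newton's identities turn power sums into elementary symmetric functions, so
  \<open>x\<close> is a root of \<open>(T - X) (T - Y) (T - Z)\<close>. Once \<open>x\<close> is
  known, the sum and \<open>e2\<close> leave a quadratic equation for \<open>y\<close>.\<close>

lemma three_reals_power_sums:
  fixes x y z X Y Z :: real
  assumes e1: "x + y + z = X + Y + Z"
    and p2: "x^2 + y^2 + z^2 = X^2 + Y^2 + Z^2"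
    and p3: "x^3 + y^3 + z^3 = X^3 + Y^3 + Z^3"
  shows "(x, y, z) \<in> {(X, Y, Z), (X, Z, Y), (Y, X, Z), (Y, Z, X), (Z, X, Y), (Z, Y, X)}"
proof -
  have e2: "x * y + y * z + z * x = X * Y + Y * Z + Z * X"
  proof -
    have "u * v + v * w + w * u = ((u + v + w)^2 - (u^2 + v^2 + w^2)) / 2" for u v w :: real
      by (simp add: power2_eq_square field_simps)
    from this[of x y z] this[of X Y Z] show ?thesis
      by (simp only: e1 p2)
  qed
  have e3: "x * y * z = X * Y * Z"
  proof -
    have "u * v * w = ((u + v + w)^3 - 3 * (u + v + w) * (u^2 + v^2 + w^2)
        + 2 * (u^3 + v^3 + w^3)) / 6" for u v w :: real
      by (simp add: power2_eq_square power3_eq_cube field_simps)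
    from this[of x y z] this[of X Y Z] show ?thesis
      by (simp only: e1 p2 p3)
  qed
  have "(x - u) * (x - v) * (x - w) = x^3 - x^2 * (u + v + w) + x * (u * v + v * w + w * u) - u * v * w"
    for u v w
    by (simp add: power2_eq_square power3_eq_cube algebra_simps)
  from this[of x y z] this[of X Y Z] have "(x - X) * (x - Y) * (x - Z) = 0"
    by (simp add: e1 e2 e3)
  then consider "x = X" | "x = Y" | "x = Z"
    by auto
  then show ?thesis
  proof cases
    case 1
    have sum: "z = Y + Z - y"
      using 1 e1 by linarith
    have "(y - Y) * (y - Z) = 0"
      using e2 unfolding 1 sum by (simp add: algebra_simps)
    with 1 sum show ?thesis by auto
  next
    case 2
    have sum: "z = X + Z - y"
      using 2 e1 by linarith
    have "(y - X) * (y - Z) = 0"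
      using e2 unfolding 2 sum by (simp add: algebra_simps)
    with 2 sum show ?thesis by auto
  next
    case 3
    have sum: "z = X + Y - y"
      using 3 e1 by linarith
    have "(y - X) * (y - Y) = 0"
      using e2 unfolding 3 sum by (simp add: algebra_simps)
    with 3 sum show ?thesis by auto
  qed
qed

text \<open>The differences \<open>s1 - S1\<close>, \<open>s2 - S2\<close>, \<open>s3 - S3\<close>
  solve a homogeneous Vandermonde system, so each one vanishes whenever its \<open>m\<close> differs
  from the other two. Where values of \<open>m\<close> coincide, the \<open>s\<close> values may be
  permuted, and the power sums of the \<open>s\<close> settle this case.\<close>

lemma three_pairs_same_first:
  fixes m1 m2 m3 s1 s2 s3 S1 S2 S3 :: real
  assumes 1: "s1 + s2 + s3 = S1 + S2 + S3"
    and 2: "s1^2 + s2^2 + s3^2 = S1^2 + S2^2 + S3^2"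
    and 3: "s1^3 + s2^3 + s3^3 = S1^3 + S2^3 + S3^3"
    and m: "m1 * s1 + m2 * s2 + m3 * s3 = m1 * S1 + m2 * S2 + m3 * S3"
    and mm: "m1^2 * s1 + m2^2 * s2 + m3^2 * s3 = m1^2 * S1 + m2^2 * S2 + m3^2 * S3"
  shows "((m1, s1), (m2, s2), (m3, s3)) \<in>
    {((m1, S1), (m2, S2), (m3, S3)), ((m1, S1), (m3, S3), (m2, S2)),
     ((m2, S2), (m1, S1), (m3, S3)), ((m2, S2), (m3, S3), (m1, S1)),
     ((m3, S3), (m1, S1), (m2, S2)), ((m3, S3), (m2, S2), (m1, S1))}"
proof -
  have vandermonde: "u1 * (n1 - n2) * (n1 - n3) = 0"
    if "u1 + u2 + u3 = 0" "n1 * u1 + n2 * u2 + n3 * u3 = 0" "n1^2 * u1 + n2^2 * u2 + n3^2 * u3 = 0"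
    for u1 u2 u3 n1 n2 n3 :: real
  proof -
    \<comment> \<open>The weights are the coefficients of \<open>(T - n2) (T - n3)\<close>, which
      cancels \<open>u2\<close> and \<open>u3\<close>.\<close>
    have "u1 * (n1 - n2) * (n1 - n3) = (n1^2 * u1 + n2^2 * u2 + n3^2 * u3)
        - (n2 + n3) * (n1 * u1 + n2 * u2 + n3 * u3) + n2 * n3 * (u1 + u2 + u3)"
      by (simp add: power2_eq_square algebra_simps)
    with that show ?thesis
      by simp
  qed
  have "(s1 - S1) * (m1 - m2) * (m1 - m3) = 0"
    by (rule vandermonde[where ?u2.0 = "s2 - S2" and ?u3.0 = "s3 - S3"])
      (use 1 m mm in \<open>simp_all add: algebra_simps\<close>)
  moreover have "(s2 - S2) * (m2 - m1) * (m2 - m3) = 0"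
    by (rule vandermonde[where ?u2.0 = "s1 - S1" and ?u3.0 = "s3 - S3"])
      (use 1 m mm in \<open>simp_all add: algebra_simps\<close>)
  moreover have "(s3 - S3) * (m3 - m1) * (m3 - m2) = 0"
    by (rule vandermonde[where ?u2.0 = "s1 - S1" and ?u3.0 = "s2 - S2"])
      (use 1 m mm in \<open>simp_all add: algebra_simps\<close>)
  ultimately have u: "s1 = S1 \<or> m1 = m2 \<or> m1 = m3" "s2 = S2 \<or> m1 = m2 \<or> m2 = m3"
    "s3 = S3 \<or> m1 = m3 \<or> m2 = m3"
    by auto
  show ?thesis
    using three_reals_power_sums[OF 1 2 3] u by (simp only: insert_iff empty_iff prod.inject) metis
qed

lemma three_pairs_moments:
  fixes m1 m2 m3 s1 s2 s3 M1 M2 M3 S1 S2 S3 :: real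
  assumes "m1 + m2 + m3 = M1 + M2 + M3"
    and "m1^2 + m2^2 + m3^2 = M1^2 + M2^2 + M3^2"
    and "m1^3 + m2^3 + m3^3 = M1^3 + M2^3 + M3^3"
    and "s1 + s2 + s3 = S1 + S2 + S3"
    and "s1^2 + s2^2 + s3^2 = S1^2 + S2^2 + S3^2"
    and "s1^3 + s2^3 + s3^3 = S1^3 + S2^3 + S3^3"
    and "m1 * s1 + m2 * s2 + m3 * s3 = M1 * S1 + M2 * S2 + M3 * S3"
    and "m1^2 * s1 + m2^2 * s2 + m3^2 * s3 = M1^2 * S1 + M2^2 * S2 + M3^2 * S3"
  shows "((m1, s1), (m2, s2), (m3, s3)) \<in>
    {((M1, S1), (M2, S2), (M3, S3)), ((M1, S1), (M3, S3), (M2, S2)),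
     ((M2, S2), (M1, S1), (M3, S3)), ((M2, S2), (M3, S3), (M1, S1)),
     ((M3, S3), (M1, S1), (M2, S2)), ((M3, S3), (M2, S2), (M1, S1))}"
proof -
  note perms = three_reals_power_sums[OF assms(1-3)]
  \<comment> \<open>The target pairs are reordered until their first components are
    \<open>m1, m2, m3\<close>; the hypotheses on the sums are symmetric under such a
    reordering.\<close>
  have *: ?thesis if "(m1, m2, m3) = (M1', M2', M3')" and
    "((M1', S1'), (M2', S2'), (M3', S3')) \<in> 
      {((M1, S1), (M2, S2), (M3, S3)), ((M1, S1), (M3, S3), (M2, S2)),
     ((M2, S2), (M1, S1), (M3, S3)), ((M2, S2), (M3, S3), (M1, S1)),
     ((M3, S3), (M1, S1), (M2, S2)), ((M3, S3), (M2, S2), (M1, S1))}"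
    for M1' M2' M3' S1' S2' S3'
  proof -
    have "((m1, s1), (m2, s2), (m3, s3)) \<in>
    {((m1, S1'), (m2, S2'), (m3, S3')), ((m1, S1'), (m3, S3'), (m2, S2')),
     ((m2, S2'), (m1, S1'), (m3, S3')), ((m2, S2'), (m3, S3'), (m1, S1')),
     ((m3, S3'), (m1, S1'), (m2, S2')), ((m3, S3'), (m2, S2'), (m1, S1'))}"
      by (rule three_pairs_same_first) (use that assms(4-8) in \<open>auto simp: add_ac\<close>)
    with that show ?thesis by auto
  qed
  from perms show ?thesis
    by (elim insertE emptyE) (erule *, blast)+
qed

text \<open>Sum and squared difference fix each pair up to a swap, and an odd number of swaps
  reverses the sign of the product of differences.\<close>

lemma aligned_four_points:
  fixes a a' b b' c c' A A' B B' C C' :: real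
  assumes m: "a + a' = A + A'" "b + b' = B + B'" "c + c' = C + C'"
    and s: "(a - a')^2 = (A - A')^2" "(b - b')^2 = (B - B')^2" "(c - c')^2 = (C - C')^2"
    and prod: "(a - a') * (b - b') * (c - c') = (A - A') * (B - B') * (C - C')"
  shows "(a, a', b, b', c, c') \<in> {(A, A', B, B', C, C'), (A, A', B', B, C', C),
    (A', A, B, B', C', C), (A', A, B', B, C, C')}"
proof -
  have swap: "u = U \<and> u' = U' \<or> u = U' \<and> u' = U"
    if "u + u' = U + U'" "(u - u')^2 = (U - U')^2" for u u' U U' :: real
  proof -
    from that(2) have "u - u' = U - U' \<or> u - u' = U' - U"
      by (simp add: power2_eq_iff)
    with that(1) show ?thesis
      by linarith
  qed
  let ?odd = "{(A', A, B, B', C, C'), (A, A', B', B, C, C'), (A, A', B, B', C', C), (A', A, B', B, C', C)}"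
  have "?thesis \<or> (a, a', b, b', c, c') \<in> ?odd"
    using swap[OF m(1) s(1)] swap[OF m(2) s(2)] swap[OF m(3) s(3)]
    by (elim disjE conjE) simp_all
  then show ?thesis
  proof
    assume odd: "(a, a', b, b', c, c') \<in> ?odd"
    then have "(a - a') * (b - b') * (c - c') = - ((A - A') * (B - B') * (C - C'))"
      by (elim insertE emptyE) (simp_all add: algebra_simps)
    with prod have "(A - A') * (B - B') * (C - C') = 0"
      by linarith
    \<comment> \<open>With a vanishing difference, swapping that pair changes nothing, so an odd
      number of swaps has the effect of an even one.\<close>
    then have "A = A' \<or> B = B' \<or> C = C'"
      by simp
    with odd show ?thesis
      by (elim disjE insertE emptyE) simp_all
  qed
qed

subsection \<open>Edge lengths of a tetrahedron\<close>

text \<open>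
  For points \<open>x, y, z, w\<close> the six edge lengths are listed as \<open>xy, zw, xz, yw, xw, yz\<close>, so that
  \<open>a, b, c\<close> meet at \<open>x\<close> and the triangle \<open>xyz\<close> has perimeter \<open>a + b + c'\<close>.  The pairs
  (coefficient, exponent) are read off from \<open>det_shifted_char_mat_4\<close>.
\<close>

abbreviation distance_terms :: "real \<Rightarrow> real \<Rightarrow> real \<Rightarrow> real \<Rightarrow> real \<Rightarrow> real \<Rightarrow> (real \<times> real) list" where
  "distance_terms a a' b b' c c' \<equiv>
    [(1, 2 * a), (1, 2 * a'), (1, 2 * b), (1, 2 * b'), (1, 2 * c), (1, 2 * c')]"

abbreviation triangle_terms :: "real \<Rightarrow> real \<Rightarrow> real \<Rightarrow> real \<Rightarrow> real \<Rightarrow> real \<Rightarrow> (real \<times> real) list" where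
  "triangle_terms a a' b b' c c' \<equiv>
    [(1, a + b + c'), (1, a + b' + c), (1, a' + b + c), (1, a' + b' + c')]"

abbreviation matching_terms :: "real \<Rightarrow> real \<Rightarrow> real \<Rightarrow> (real \<times> real) list" where
  "matching_terms m1 m2 m3 \<equiv>
    [(1, 2 * m1), (1, 2 * m2), (1, 2 * m3), (- 2, m1 + m2), (- 2, m1 + m3), (- 2, m2 + m3)]"

text \<open>Each moment is solved for the next power sum of the \<open>m\<close>. The fourth follows
  from the first three by Newton's identities in three variables; it is needed to extract the sum of
  \<open>m^2 * s\<close> from the distances.\<close>

lemma matching_terms_moments:
  fixes m1 m2 m3 :: real
  defines "p \<equiv> \<lambda>k. m1 ^ k + m2 ^ k + m3 ^ k"
  shows "p 1 = - moment (matching_terms m1 m2 m3) 1 / 2"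
    and "p 2 = moment (matching_terms m1 m2 m3) 2 / 2 + p 1 ^ 2"
    and "p 3 = (moment (matching_terms m1 m2 m3) 3 + 6 * p 1 * p 2) / 10"
    and "p 4 = (p 1 ^ 4 - 6 * p 1 ^ 2 * p 2 + 3 * p 2 ^ 2 + 8 * p 1 * p 3) / 6"
  by (simp_all add: p_def power2_eq_square power3_eq_cube power4_eq_xxxx field_simps)

text \<open>Twice a perimeter minus the total edge length \<open>S\<close> is a signed sum of the
  three differences whose signs multiply to -1. In the power sums of these four values all terms
  with unbalanced signs cancel: the second gives \<open>s 1\<close>, the third \<open>r\<close>, the
  fourth \<open>s 2\<close>. Finally \<open>r^2\<close> is the product of the squared differences,
  so Newton's identities give \<open>s 3\<close>.\<close>

lemma triangle_terms_moments:
  fixes a a' b b' c c' :: real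
  defines "M \<equiv> moment (triangle_terms a a' b b' c c')"
    and "S \<equiv> a + a' + b + b' + c + c'"
    and "s \<equiv> \<lambda>k. ((a - a')^2) ^ k + ((b - b')^2) ^ k + ((c - c')^2) ^ k"
    and "r \<equiv> (a - a') * (b - b') * (c - c')"
  shows "s 1 = M 2 - S * M 1 + S^2"
    and "r = (4 * S^3 - 6 * S^2 * M 1 + 12 * S * M 2 - 8 * M 3) / 24"
    and "s 2 = (3 * s 1 ^ 2
      - (16 * M 4 - 32 * S * M 3 + 24 * S^2 * M 2 - 8 * S^3 * M 1 + 4 * S^4) / 4) / 2"
    and "s 3 = 3 * r^2 + (3 * s 1 * s 2 - s 1 ^ 3) / 2"
proof -
  define \<alpha> \<beta> \<gamma> where "\<alpha> = a - a'" and "\<beta> = b - b'" and "\<gamma> = c - c'"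
  define v1 v2 v3 v4 where v: "v1 = \<alpha> + \<beta> - \<gamma>" "v2 = \<alpha> - \<beta> + \<gamma>" "v3 = - \<alpha> + \<beta> + \<gamma>" "v4 = - \<alpha> - \<beta> - \<gamma>"
  define p1 p2 p3 p4 where p: "p1 = a + b + c'" "p2 = a + b' + c" "p3 = a' + b + c" "p4 = a' + b' + c'"
  have vp: "v1 = 2 * p1 - S" "v2 = 2 * p2 - S" "v3 = 2 * p3 - S" "v4 = 2 * p4 - S"
    unfolding v p \<alpha>_def \<beta>_def \<gamma>_def S_def by simp_all
  have M: "M k = p1 ^ k + p2 ^ k + p3 ^ k + p4 ^ k" for k
    by (simp add: M_def p)
  have s: "s k = (\<alpha>^2)^k + (\<beta>^2)^k + (\<gamma>^2)^k" for k
    by (simp add: s_def \<alpha>_def \<beta>_def \<gamma>_def)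
  have r: "r = \<alpha> * \<beta> * \<gamma>"
    by (simp add: r_def \<alpha>_def \<beta>_def \<gamma>_def)
  have V2: "v1^2 + v2^2 + v3^2 + v4^2 = 4 * M 2 - 4 * S * M 1 + 4 * S^2"
    unfolding vp M by (simp add: power2_eq_square algebra_simps)
  have V3: "v1^3 + v2^3 + v3^3 + v4^3 = 8 * M 3 - 12 * S * M 2 + 6 * S^2 * M 1 - 4 * S^3"
    unfolding vp M by (simp add: power2_eq_square power3_eq_cube algebra_simps)
  have V4: "v1^4 + v2^4 + v3^4 + v4^4 = 16 * M 4 - 32 * S * M 3 + 24 * S^2 * M 2 - 8 * S^3 * M 1 + 4 * S^4"
    unfolding vp M by (simp add: power2_eq_square power3_eq_cube power4_eq_xxxx algebra_simps)
  have "v1^2 + v2^2 + v3^2 + v4^2 = 4 * s 1"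
    unfolding v s by (simp add: power2_eq_square algebra_simps)
  with V2 show "s 1 = M 2 - S * M 1 + S^2"
    by linarith
  have "v1^3 + v2^3 + v3^3 + v4^3 = - 24 * r"
    unfolding v r by (simp add: power3_eq_cube algebra_simps)
  with V3 show "r = (4 * S^3 - 6 * S^2 * M 1 + 12 * S * M 2 - 8 * M 3) / 24"
    by (simp add: field_simps)
  have "v1^4 + v2^4 + v3^4 + v4^4 = 12 * s 1 ^ 2 - 8 * s 2"
    unfolding v s by (simp add: power2_eq_square power4_eq_xxxx algebra_simps)
  with V4 show "s 2 = (3 * s 1 ^ 2
      - (16 * M 4 - 32 * S * M 3 + 24 * S^2 * M 2 - 8 * S^3 * M 1 + 4 * S^4) / 4) / 2"
    by (simp add: field_simps)
  have "x^3 + y^3 + z^3 =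
      3 * (x * y * z) + (3 * (x + y + z) * (x^2 + y^2 + z^2) - (x + y + z)^3) / 2" for x y z :: real
    by (simp add: power2_eq_square power3_eq_cube field_simps)
  from this[of "\<alpha>^2" "\<beta>^2" "\<gamma>^2"] show "s 3 = 3 * r^2 + (3 * s 1 * s 2 - s 1 ^ 3) / 2"
    unfolding s r by (simp only: power_mult_distrib power_one_right)
qed

text \<open>With m and \<delta> the sum and difference of opposite edges, twice the edges are m +
  \<delta> and m - \<delta>. Odd powers of \<delta> cancel in the binomial expansions, leaving m
  \<delta>^2 in the cubes and m^2 \<delta>^2 in the fourth powers as the new information.\<close>

lemma distance_terms_moments:
  fixes a a' b b' c c' :: real
  defines "M \<equiv> moment (distance_terms a a' b b' c c')"
  shows "(a + a') * (a - a')^2 + (b + b') * (b - b')^2 + (c + c') * (c - c')^2 =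
      (M 3 - 2 * ((a + a')^3 + (b + b')^3 + (c + c')^3)) / 6" (is ?th1)
    and "(a + a')^2 * (a - a')^2 + (b + b')^2 * (b - b')^2 + (c + c')^2 * (c - c')^2 =
      (M 4 - 2 * ((a + a')^4 + (b + b')^4 + (c + c')^4)
        - 2 * (((a - a')^2)^2 + ((b - b')^2)^2 + ((c - c')^2)^2)) / 12" (is ?th2)
proof -
  have 3: "(2 * u)^3 + (2 * u')^3 = 2 * (u + u')^3 + 6 * ((u + u') * (u - u')^2)" for u u' :: real
    by (simp add: power2_eq_square power3_eq_cube algebra_simps)
  have 4: "(2 * u)^4 + (2 * u')^4 = 2 * (u + u')^4 + 12 * ((u + u')^2 * (u - u')^2) + 2 * ((u - u')^2)^2"
    for u u' :: real
    by (simp add: power2_eq_square power4_eq_xxxx algebra_simps)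
  have "M k = ((2 * a)^k + (2 * a')^k) + ((2 * b)^k + (2 * b')^k) + ((2 * c)^k + (2 * c')^k)" for k
    by (simp only: M_def moment_simps mult_1 add_0_right add.assoc)
  note M = this
  show ?th1
    using M[of 3] unfolding 3 by (simp add: field_simps)
  show ?th2
    using M[of 4] unfolding 4 by (simp add: field_simps)
qed

lemma four_points_moments:
  fixes a a' b b' c c' A A' B B' C C' :: real
  assumes dist: "\<And>k. moment (distance_terms a a' b b' c c') k = moment (distance_terms A A' B B' C C') k"
    and tri: "\<And>k. moment (triangle_terms a a' b b' c c') k = moment (triangle_terms A A' B B' C C') k"
    and mat: "\<And>k. moment (matching_terms (a + a') (b + b') (c + c')) k =
      moment (matching_terms (A + A') (B + B') (C + C')) k"
  shows "((a + a', (a - a')^2), (b + b', (b - b')^2), (c + c', (c - c')^2)) \<in>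
    {((A + A', (A - A')^2), (B + B', (B - B')^2), (C + C', (C - C')^2)),
     ((A + A', (A - A')^2), (C + C', (C - C')^2), (B + B', (B - B')^2)),
     ((B + B', (B - B')^2), (A + A', (A - A')^2), (C + C', (C - C')^2)),
     ((B + B', (B - B')^2), (C + C', (C - C')^2), (A + A', (A - A')^2)),
     ((C + C', (C - C')^2), (A + A', (A - A')^2), (B + B', (B - B')^2)),
     ((C + C', (C - C')^2), (B + B', (B - B')^2), (A + A', (A - A')^2))}"
    and "(a - a') * (b - b') * (c - c') = (A - A') * (B - B') * (C - C')"
proof -
  \<comment> \<open>Rewriting with \<open>mat\<close> expresses the quantities of both spaces
    through the same moments. They are then compared in order, as each formula uses the earlier
    ones.\<close>
  note mm = matching_terms_moments[of "a + a'" "b + b'" "c + c'", unfolded mat]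
  note MM = matching_terms_moments[of "A + A'" "B + B'" "C + C'"]
  have m1: "(a + a') ^ 1 + (b + b') ^ 1 + (c + c') ^ 1 = (A + A') ^ 1 + (B + B') ^ 1 + (C + C') ^ 1"
    unfolding mm(1) MM(1) ..
  have m2: "(a + a')^2 + (b + b')^2 + (c + c')^2 = (A + A')^2 + (B + B')^2 + (C + C')^2"
    unfolding mm(2) MM(2) m1 ..
  have m3: "(a + a')^3 + (b + b')^3 + (c + c')^3 = (A + A')^3 + (B + B')^3 + (C + C')^3"
    unfolding mm(3) MM(3) m1 m2 ..
  have m4: "(a + a')^4 + (b + b')^4 + (c + c')^4 = (A + A')^4 + (B + B')^4 + (C + C')^4"
    unfolding mm(4) MM(4) m1 m2 m3 ..
  have S: "a + a' + b + b' + c + c' = A + A' + B + B' + C + C'"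
    using m1 by simp
  note tt = triangle_terms_moments[of a a' b b' c c', unfolded tri S]
  note TT = triangle_terms_moments[of A A' B B' C C']
  show r: "(a - a') * (b - b') * (c - c') = (A - A') * (B - B') * (C - C')"
    unfolding tt(2) TT(2) ..
  have s1: "((a - a')^2)^1 + ((b - b')^2)^1 + ((c - c')^2)^1 =
      ((A - A')^2)^1 + ((B - B')^2)^1 + ((C - C')^2)^1"
    unfolding tt(1) TT(1) ..
  have s2: "((a - a')^2)^2 + ((b - b')^2)^2 + ((c - c')^2)^2 =
      ((A - A')^2)^2 + ((B - B')^2)^2 + ((C - C')^2)^2"
    unfolding tt(3) TT(3) s1 ..
  have s3: "((a - a')^2)^3 + ((b - b')^2)^3 + ((c - c')^2)^3 =
      ((A - A')^2)^3 + ((B - B')^2)^3 + ((C - C')^2)^3"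
    unfolding tt(4) TT(4) s1 s2 r ..
  note dd = distance_terms_moments[of a a' b b' c c', unfolded dist m3 m4 s2]
  note DD = distance_terms_moments[of A A' B B' C C']
  show "((a + a', (a - a')^2), (b + b', (b - b')^2), (c + c', (c - c')^2)) \<in>
    {((A + A', (A - A')^2), (B + B', (B - B')^2), (C + C', (C - C')^2)),
     ((A + A', (A - A')^2), (C + C', (C - C')^2), (B + B', (B - B')^2)),
     ((B + B', (B - B')^2), (A + A', (A - A')^2), (C + C', (C - C')^2)),
     ((B + B', (B - B')^2), (C + C', (C - C')^2), (A + A', (A - A')^2)),
     ((C + C', (C - C')^2), (A + A', (A - A')^2), (B + B', (B - B')^2)),
     ((C + C', (C - C')^2), (B + B', (B - B')^2), (A + A', (A - A')^2))}"
    using m1 m2 m3 s1 s2 s3 dd DD by (intro three_pairs_moments) (simp_all only: power_one_right)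
qed

subsection \<open>Reconstruction of the metric space\<close>

text \<open>Pairs \<open>i < j\<close> suffice: symmetry and zero self-distances supply the
  rest.\<close>

lemma isometric_if_lists:
  assumes "distinct xs" "distinct ys" "length xs = length ys"
    and "Metric_space (set xs) d" "Metric_space (set ys) d'"
    and eq: "\<And>i j. i < j \<Longrightarrow> j < length xs \<Longrightarrow> d' (ys ! i) (ys ! j) = d (xs ! i) (xs ! j)"
  shows "isometric (set xs) d (set ys) d'"
proof -
  interpret X: Metric_space "set xs" d by fact
  interpret Y: Metric_space "set ys" d' by fact
  have eq': "d' (ys ! i) (ys ! j) = d (xs ! i) (xs ! j)"
    if "i < length xs" "j < length xs" for i j
    using that eq[of i j] eq[of j i] assms(3) X.commute Y.commute
    by (cases i j rule: linorder_cases) auto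
  have X: "bij_betw ((!) xs) {..<length xs} (set xs)"
    using \<open>distinct xs\<close> by (intro bij_betw_nth) auto
  have Y: "bij_betw ((!) ys) {..<length xs} (set ys)"
    using assms(2,3) by (intro bij_betw_nth) auto
  define f where "f = (!) ys \<circ> inv_into {..<length xs} ((!) xs)"
  have "bij_betw f (set xs) (set ys)"
    unfolding f_def by (rule bij_betw_trans[OF bij_betw_inv_into[OF X] Y])
  moreover have f: "f (xs ! i) = ys ! i" if "i < length xs" for i
    using that bij_betw_inv_into_left[OF X, of i] by (simp add: f_def)
  have "d' (f x) (f y) = d x y" if "x \<in> set xs" "y \<in> set xs" for x y
    using that by (metis in_set_conv_nth f eq')
  ultimately show ?thesis
    by (auto simp: isometric_def)
qed

lemma isometric_three_points:
  assumes "Metric_space {x, y, z} d" "Metric_space {x', y', z'} d'"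
    and "distinct [x, y, z]" "distinct [x', y', z']"
    and "d x y = d' x' y'" "d x z = d' x' z'" "d y z = d' y' z'"
  shows "isometric {x, y, z} d {x', y', z'} d'"
  using isometric_if_lists[of "[x, y, z]" "[x', y', z']" d d'] assms
  by (force simp: less_Suc_eq numeral_3_eq_3)

lemma isometric_four_points:
  assumes "Metric_space {x, y, z, w} d" "Metric_space {x', y', z', w'} d'"
    and "distinct [x, y, z, w]" "distinct [x', y', z', w']"
    and "d x y = d' x' y'" "d z w = d' z' w'" "d x z = d' x' z'" "d y w = d' y' w'"
      "d x w = d' x' w'" "d y z = d' y' z'"
  shows "isometric {x, y, z, w} d {x', y', z', w'} d'"
proof -
  have "isometric (set [x, y, z, w]) d (set [x', y', z', w']) d'"
  proof (rule isometric_if_lists)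
    fix i j
    assume "i < j" "j < length [x, y, z, w]"
    then have "(i, j) \<in> {(0, 1), (0, 2), (0, 3), (1, 2), (1, 3), (2, 3)}"
      by auto
    then show "d' ([x', y', z', w'] ! i) ([x', y', z', w'] ! j) = d ([x, y, z, w] ! i) ([x, y, z, w] ! j)"
      using assms(5-10) by auto
  qed (use assms(1-4) in auto)
  then show ?thesis
    by simp
qed

text \<open>A double transposition of the points fixes the edges of one perfect matching and swaps
  the two edges in each of the others. These are the even swaps left by
  \<open>aligned_four_points\<close>.\<close>

lemma isometric_four_points_aligned:
  assumes "Metric_space {x, y, z, w} d" and Y: "Metric_space {x', y', z', w'} d'"
    and "distinct [x, y, z, w]" "distinct [x', y', z', w']"
    and m: "d x y + d z w = d' x' y' + d' z' w'" "d x z + d y w = d' x' z' + d' y' w'"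
      "d x w + d y z = d' x' w' + d' y' z'"
    and s: "(d x y - d z w)^2 = (d' x' y' - d' z' w')^2" "(d x z - d y w)^2 = (d' x' z' - d' y' w')^2"
      "(d x w - d y z)^2 = (d' x' w' - d' y' z')^2"
    and r: "(d x y - d z w) * (d x z - d y w) * (d x w - d y z) =
      (d' x' y' - d' z' w') * (d' x' z' - d' y' w') * (d' x' w' - d' y' z')"
  shows "isometric {x, y, z, w} d {x', y', z', w'} d'"
proof -
  note comm = Metric_space.commute[OF Y]
  have iso: "isometric {x, y, z, w} d {x', y', z', w'} d'"
    if "{p, q, r, s} = {x', y', z', w'}" "distinct [p, q, r, s]"
      "d x y = d' p q" "d z w = d' r s" "d x z = d' p r" "d y w = d' q s" "d x w = d' p s" "d y z = d' q r"
    for p q r s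
    using isometric_four_points[of x y z w d p q r s d'] that assms(1-3) by simp
  from aligned_four_points[OF m s r] consider
    "d x y = d' x' y'" "d z w = d' z' w'" "d x z = d' x' z'" "d y w = d' y' w'" "d x w = d' x' w'" "d y z = d' y' z'"
  | "d x y = d' x' y'" "d z w = d' z' w'" "d x z = d' y' w'" "d y w = d' x' z'" "d x w = d' y' z'" "d y z = d' x' w'"
  | "d x y = d' z' w'" "d z w = d' x' y'" "d x z = d' x' z'" "d y w = d' y' w'" "d x w = d' y' z'" "d y z = d' x' w'"
  | "d x y = d' z' w'" "d z w = d' x' y'" "d x z = d' y' w'" "d y w = d' x' z'" "d x w = d' x' w'" "d y z = d' y' z'"
    by auto
  then show ?thesis
  proof cases
    case 1
    then show ?thesis
      using assms(4) by (intro iso[of x' y' z' w']) auto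
  next
    case 2
    then show ?thesis
      using assms(4) comm by (intro iso[of y' x' w' z']) auto
  next
    case 3
    then show ?thesis
      using assms(4) comm by (intro iso[of z' w' x' y']) auto
  next
    case 4
    then show ?thesis
      using assms(4) comm by (intro iso[of w' z' y' x']) auto
  qed
qed

section \<open>From equal q-spectra to isometry for four, three and two points\<close>

lemma four_points_q_spectrum:
  assumes X: "Metric_space (set [x, y, z, w]) d" and Y: "Metric_space (set [x', y', z', w']) d'"
    and dist: "distinct [x, y, z, w]" "distinct [x', y', z', w']"
    and eq: "\<forall>q\<in>{0<..<1}. q_spectrum d [x, y, z, w] q = q_spectrum d' [x', y', z', w'] q"
  shows "isometric (set [x, y, z, w]) d (set [x', y', z', w']) d'"
proof -
  note commX = Metric_space.commute[OF X] and commY = Metric_space.commute[OF Y]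
  let ?D = "distance_terms (d x y) (d z w) (d x z) (d y w) (d x w) (d y z)"
  let ?T = "triangle_terms (d x y) (d z w) (d x z) (d y w) (d x w) (d y z)"
  let ?M = "matching_terms (d x y + d z w) (d x z + d y w) (d x w + d y z)"
  let ?D' = "distance_terms (d' x' y') (d' z' w') (d' x' z') (d' y' w') (d' x' w') (d' y' z')"
  let ?T' = "triangle_terms (d' x' y') (d' z' w') (d' x' z') (d' y' w') (d' x' w') (d' y' z')"
  let ?M' = "matching_terms (d' x' y' + d' z' w') (d' x' z' + d' y' w') (d' x' w' + d' y' z')"
  have det: "\<mu>^4 - \<mu>^2 * exp_sum ?D t - 2 * \<mu> * exp_sum ?T t + exp_sum ?M t =
      \<mu>^4 - \<mu>^2 * exp_sum ?D' t - 2 * \<mu> * exp_sum ?T' t + exp_sum ?M' t" if "t < 0" for t \<mu>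
    using q_spectrum_eq_imp_det_eq[OF X Y eq that, of \<mu>]
      det_shifted_char_mat_4[where d = d and x = x and y = y and z = z and w = w, OF commX commX commX commX commX commX, of t \<mu>]
      det_shifted_char_mat_4[where d = d' and x = x' and y = y' and z = z' and w = w', OF commY commY commY commY commY commY, of t \<mu>]
    by (simp add: algebra_simps)
  \<comment> \<open>The value \<mu> = 0 isolates the constant term; sum and difference of \<mu> = 1
    and \<mu> = -1 separate the other two.\<close>
  have "exp_sum ?D t = exp_sum ?D' t \<and> exp_sum ?T t = exp_sum ?T' t \<and> exp_sum ?M t = exp_sum ?M' t"
    if "t < 0" for t
    using det[OF that, of 0] det[OF that, of 1] det[OF that, of "- 1"]
    by (simp del: exp_sum_simps)
  then have mom: "moment ?D k = moment ?D' k" "moment ?T k = moment ?T' k" "moment ?M k = moment ?M' k" for k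
    by (blast intro: exp_sum_eq_imp_moment_eq)+
  \<comment> \<open>Permuting \<open>y', z', w'\<close> with \<open>x'\<close> fixed realises every
    permutation of the three matchings. Each difference remains an edge at \<open>x'\<close> minus
    its opposite edge, so the product in the last premise is preserved.\<close>
  have iso: ?thesis
    if "set [p, q, u, v] = set [x', y', z', w']" "distinct [p, q, u, v]"
      "(d x y + d z w, (d x y - d z w)^2) = (d' p q + d' u v, (d' p q - d' u v)^2)"
      "(d x z + d y w, (d x z - d y w)^2) = (d' p u + d' q v, (d' p u - d' q v)^2)"
      "(d x w + d y z, (d x w - d y z)^2) = (d' p v + d' q u, (d' p v - d' q u)^2)"
      "(d' x' y' - d' z' w') * (d' x' z' - d' y' w') * (d' x' w' - d' y' z') =
        (d' p q - d' u v) * (d' p u - d' q v) * (d' p v - d' q u)" for p q u v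
    using isometric_four_points_aligned[of x y z w d p q u v d'] that X Y dist
      four_points_moments(2)[OF mom] by simp
  from four_points_moments(1)[OF mom] show ?thesis
    apply (elim insertE emptyE)
    subgoal using dist by (intro iso[of x' y' z' w']) auto
    subgoal using dist commY by (intro iso[of x' y' w' z']) auto
    subgoal using dist commY by (intro iso[of x' z' y' w']) auto
    subgoal using dist commY by (intro iso[of x' z' w' y']) auto
    subgoal using dist commY by (intro iso[of x' w' y' z']) auto
    subgoal using dist commY by (intro iso[of x' w' z' y']) auto
    done
qed

text \<open>The moments determine the three side lengths up to order, and every permutation of the
  sides of a triangle comes from one of its vertices.\<close>

lemma three_points_q_spectrum:
  assumes X: "Metric_space (set [x, y, z]) d" and Y: "Metric_space (set [x', y', z']) d'"
    and dist: "distinct [x, y, z]" "distinct [x', y', z']"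
    and eq: "\<forall>q\<in>{0<..<1}. q_spectrum d [x, y, z] q = q_spectrum d' [x', y', z'] q"
  shows "isometric (set [x, y, z]) d (set [x', y', z']) d'"
proof -
  note commX = Metric_space.commute[OF X] and commY = Metric_space.commute[OF Y]
  let ?D = "[(1, 2 * d x y), (1, 2 * d x z), (1, 2 * d y z)]"
  let ?D' = "[(1, 2 * d' x' y'), (1, 2 * d' x' z'), (1, 2 * d' y' z')]"
  define E E' where "E t = exp ((d x y + d x z + d y z) * t)"
    and "E' t = exp ((d' x' y' + d' x' z' + d' y' z') * t)" for t
  have det: "\<mu>^3 - \<mu> * exp_sum ?D t - 2 * E t = \<mu>^3 - \<mu> * exp_sum ?D' t - 2 * E' t" if "t < 0" for t \<mu>
    using q_spectrum_eq_imp_det_eq[OF X Y eq that, of \<mu>]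
      det_shifted_char_mat_3[where d = d and x = x and y = y and z = z, OF commX commX commX, of t \<mu>]
      det_shifted_char_mat_3[where d = d' and x = x' and y = y' and z = z', OF commY commY commY, of t \<mu>]
    by (simp add: E_def E'_def algebra_simps)
  have "exp_sum ?D t = exp_sum ?D' t" if "t < 0" for t
    using det[OF that, of 0] det[OF that, of 1] by (simp del: exp_sum_simps)
  then have mom: "moment ?D k = moment ?D' k" for k
    by (rule exp_sum_eq_imp_moment_eq)
  have "(d x y, d x z, d y z) \<in> {(d' x' y', d' x' z', d' y' z'), (d' x' y', d' y' z', d' x' z'),
    (d' x' z', d' x' y', d' y' z'), (d' x' z', d' y' z', d' x' y'),
    (d' y' z', d' x' y', d' x' z'), (d' y' z', d' x' z', d' x' y')}"
    using mom[of 1] mom[of 2] mom[of 3]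
    by (intro three_reals_power_sums) (simp_all add: power_mult_distrib)
  moreover have iso: ?thesis
    if "set [p, q, u] = set [x', y', z']" "distinct [p, q, u]"
      "d x y = d' p q" "d x z = d' p u" "d y z = d' q u" for p q u
    using isometric_three_points[of x y z d p q u d'] that X Y dist by simp
  ultimately show ?thesis
    apply (elim insertE emptyE)
    subgoal using dist by (intro iso[of x' y' z']) auto
    subgoal using dist commY by (intro iso[of y' x' z']) auto
    subgoal using dist commY by (intro iso[of x' z' y']) auto
    subgoal using dist commY by (intro iso[of z' x' y']) auto
    subgoal using dist commY by (intro iso[of y' z' x']) auto
    subgoal using dist commY by (intro iso[of z' y' x']) auto
    done
qed

lemma two_points_q_spectrum:
  assumes X: "Metric_space (set [x, y]) d" and Y: "Metric_space (set [x', y']) d'"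
    and dist: "distinct [x, y]" "distinct [x', y']"
    and eq: "\<forall>q\<in>{0<..<1}. q_spectrum d [x, y] q = q_spectrum d' [x', y'] q"
  shows "isometric (set [x, y]) d (set [x', y']) d'"
proof -
  \<comment> \<open>At \<mu> = 0 the determinant is \<open>- exp (2 * d x y * t)\<close>, so the
    single value \<open>t = - 1\<close> determines the distance.\<close>
  have "d x y = d' x' y'"
    using q_spectrum_eq_imp_det_eq[OF X Y eq, of "- 1" 0]
      det_shifted_char_mat_2[where d = d and x = x and y = y, OF Metric_space.commute[OF X], of "- 1" 0]
      det_shifted_char_mat_2[where d = d' and x = x' and y = y', OF Metric_space.commute[OF Y], of "- 1" 0]
    by simp
  then show ?thesis
    using X Y dist by (intro isometric_if_lists) (auto simp: less_Suc_eq)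
qed

theorem theorem3p3:
  fixes X :: "'a set" and d :: "'a \<Rightarrow> 'a \<Rightarrow> real" and xs :: "'a list"
    and X' :: "'b set" and d' :: "'b \<Rightarrow> 'b \<Rightarrow> real" and xs' :: "'b list"
  assumes "Metric_space X d" and "finite X" and "card X \<le> 4"
    and "Metric_space X' d'" and "finite X'" and "card X' \<le> 4"
    and "distinct xs" and "set xs = X"
    and "distinct xs'" and "set xs' = X'"
    and "\<forall>q\<in>{0<..<1}. q_spectrum d xs q = q_spectrum d' xs' q"
  shows "isometric X d X' d'"
proof -
  have M: "Metric_space (set xs) d" "Metric_space (set xs') d'"
    using assms by auto
  have len: "length xs' = length xs"
    using q_spectrum_eq_imp_length_eq[OF assms(11)] by simp
  have "length xs \<le> 4"
    using assms(3,7,8) distinct_card by fastforce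
  then consider "length xs \<le> 1" | "length xs = 2" | "length xs = 3" | "length xs = 4"
    by linarith
  then have "isometric (set xs) d (set xs') d'"
  proof cases
    case 1
    then show ?thesis
      using M assms(7,9) len by (intro isometric_if_lists) auto
  next
    case 2
    then obtain x y x' y' where "xs = [x, y]" "xs' = [x', y']"
      using len by (auto simp: length_Suc_conv numeral_2_eq_2)
    then show ?thesis
      using two_points_q_spectrum M assms(7,9,11) by metis
  next
    case 3
    then obtain x y z x' y' z' where "xs = [x, y, z]" "xs' = [x', y', z']"
      using len by (auto simp: length_Suc_conv numeral_3_eq_3)
    then show ?thesis
      using three_points_q_spectrum M assms(7,9,11) by metis
  next
    case 4
    then obtain x y z w x' y' z' w' where "xs = [x, y, z, w]" "xs' = [x', y', z', w']"
      using len by (auto simp: length_Suc_conv eval_nat_numeral)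
    then show ?thesis
      using four_points_q_spectrum M assms(7,9,11) by metis
  qed
  with assms(8,10) show ?thesis
    by simp
qed

end
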